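(* Let $s\in\mathbb{R}$. (i) Let $p\in(0,\infty)$. If $q\in(p,\infty)$ and $\tau\in(0,1/p-1/q]$, or if $q=\infty$ and $\tau\in(0,1/p-1/q)$, then $\dot{b}^{s,\tau+1/q-1/p}_{q,q}(\mathbb{R}^n)$ is a proper subspace of $\dot{f}^{s,\tau}_{p,q}(\mathbb{R}^n)$. (ii) Let $p\in(0,\infty)$. If $q\in(p,\infty)$ and $\tau\in(0,1/p-1/q]$, or if $q=\infty$ and $\tau\in[0,1/p-1/q)$, then $\dot{b}^{s,\tau+1/q-1/p}_{q,q}(\mathbb{R}^n)$ is a proper subspace of $\dot{b}^{s,\tau}_{p,q}(\mathbb{R}^n)$.
   Context: $\mathcal{Q}$ is the set of all dyadic cubes $Q_{jk}=2^{-j}([0,1)^n+k)$, $j\in\mathbb{Z}$, $k\in\mathbb{Z}^n$, in $\mathbb{R}^n$. For $Q\in\mathcal{Q}$, $|Q|$ is its Lebesgue measure, $\ell(Q)$ its side-length, $j_Q=-\log_2\ell(Q)$, and $\chi_Q$ its characteristic function. Sums over $Q\subset P$ run over dyadic cubes $Q\in\mathcal{Q}$ contained in $P$. Convention: $1/q=0$ if $q=\infty$. For $s\in\mathbb{R}$, $\tau\in\mathbb{R}$, $q\in(0,\infty]$ and sequences $t=\{t_Q\}_{Q\in\mathcal{Q}}\subset\mathbb{C}$ define, for $p\in(0,\infty)$, $$\|t\|_{\dot{f}^{s,\tau}_{p,q}(\mathbb{R}^n)}=\sup_{P\in\mathcal{Q}}\frac1{|P|^{\tau}}\left\{\int_P\left(\sum_{Q\subset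 P}\left[|Q|^{-s/n-1/2}|t_Q|\chi_Q(x)\right]^q\right)^{p/q}dx\right\}^{1/p},$$ and, for $p\in(0,\infty]$, $$\|t\|_{\dot{b}^{s,\tau}_{p,q}(\mathbb{R}^n)}=\sup_{P\in\mathcal{Q}}\frac1{|P|^{\tau}}\left\{\sum_{j=j_P}^\infty\left(\int_P\left[\sum_{Q\subset P,\ \ell(Q)=2^{-j}}|Q|^{-s/n-1/2}|t_Q|\chi_Q(x)\right]^pdx\right)^{q/p}\right\}^{1/q},$$ with the usual modifications when $p=\infty$ or $q=\infty$ (the integral quasi-norm becomes an essential supremum over $P$, the $\ell^q$ quasi-norm becomes a supremum). The spaces $\dot{f}^{s,\tau}_{p,q}(\mathbb{R}^n)$ and $\dot{b}^{s,\tau}_{p,q}(\mathbb{R}^n)$ consist of all sequences $t$ for which the respective quantity is finite. *)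

theory Defs
  imports "HOL-Probability.Essential_Supremum" "HOL-Library.Function_Algebras"
begin

section \<open>Dyadic cubes\<close>

definition dyadic_cube :: "int \<Rightarrow> int ^ 'n \<Rightarrow> (real ^ 'n) set" where
  "dyadic_cube j k =
     {x. \<forall>i. 2 powi (- j) * real_of_int (k $ i) \<le> x $ i \<and>
             x $ i < 2 powi (- j) * (real_of_int (k $ i) + 1)}"

definition dyadic_cubes_at :: "int \<Rightarrow> (real ^ 'n) set set" where
  "dyadic_cubes_at j = range (dyadic_cube j)"

definition dyadic_cubes :: "(real ^ 'n) set set" where
  "dyadic_cubes = (\<Union>j. dyadic_cubes_at j)"


section \<open>Quasi-norms with exponents in (0, \<infinity>]\<close>

text \<open>Powers of extended nonnegative reals; only used for exponents \<open>a > 0\<close>.\<close>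

definition epowr :: "ennreal \<Rightarrow> real \<Rightarrow> ennreal" where
  "epowr x a = (if x = \<infinity> then \<infinity> else ennreal (enn2real x powr a))"

text \<open>The reciprocal of an exponent in (0, \<open>\<infinity>\<close>], with value \<open>0\<close> at \<open>\<infinity>\<close>.\<close>

definition recip :: "ennreal \<Rightarrow> real" where
  "recip q = (if q = \<infinity> then 0 else 1 / enn2real q)"

definition lq_qnorm :: "ennreal \<Rightarrow> 'i set \<Rightarrow> ('i \<Rightarrow> ennreal) \<Rightarrow> ennreal" where
  "lq_qnorm q I a =
     (if q = \<infinity> then (SUP i\<in>I. a i)
      else epowr (\<Sum>\<^sub>\<infinity>i\<in>I. epowr (a i) (enn2real q)) (recip q))"

definition Lp_qnorm :: "ennreal \<Rightarrow> (real ^ 'n) set \<Rightarrow> (real ^ 'n \<Rightarrow> ennreal) \<Rightarrow> ennreal" where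
  "Lp_qnorm p P f =
     (if p = \<infinity> then esssup (restrict_space lborel P) f
      else epowr (\<integral>\<^sup>+x\<in>P. epowr (f x) (enn2real p) \<partial>lborel) (recip p))"


section \<open>Triebel-Lizorkin-type and Besov-type sequence spaces\<close>

text \<open>
  A sequence indexed by the dyadic cubes is represented by a function on all sets that
  vanishes off the dyadic cubes.
\<close>

type_synonym 'n cube_seq = "(real ^ 'n) set \<Rightarrow> complex"

definition seq_term :: "real \<Rightarrow> 'n::finite cube_seq \<Rightarrow> (real ^ 'n) set \<Rightarrow> real ^ 'n \<Rightarrow> ennreal" where
  "seq_term s t Q x =
     ennreal (measure lborel Q powr (- s / real CARD('n) - 1 / 2) * cmod (t Q) * indicator Q x)"

text \<open>
  In \<open>f_qnorm\<close> the innermost \<open>\<ell>\<^sup>q\<close> quasi-norm is \<open>(\<Sum> [\<dots>]\<^sup>q)\<^bsup>1/q\<^esup>\<close>, whose \<open>p\<close>-th power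
  is the integrand \<open>(\<Sum> [\<dots>]\<^sup>q)\<^bsup>p/q\<^esup>\<close>.
\<close>

definition f_qnorm :: "real \<Rightarrow> real \<Rightarrow> real \<Rightarrow> ennreal \<Rightarrow> 'n::finite cube_seq \<Rightarrow> ennreal" where
  "f_qnorm s \<tau> p q t =
     (SUP P\<in>dyadic_cubes.
        ennreal (1 / measure lborel P powr \<tau>) *
        Lp_qnorm (ennreal p) P
          (\<lambda>x. lq_qnorm q {Q \<in> dyadic_cubes. Q \<subseteq> P} (\<lambda>Q. seq_term s t Q x)))"

text \<open>The supremum over all cubes \<open>P\<close> is taken level by level, so that \<open>i\<close> is \<open>j\<^sub>P\<close>.\<close>

definition b_qnorm :: "real \<Rightarrow> real \<Rightarrow> ennreal \<Rightarrow> ennreal \<Rightarrow> 'n::finite cube_seq \<Rightarrow> ennreal" where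
  "b_qnorm s \<tau> p q t =
     (SUP i. SUP P\<in>dyadic_cubes_at i.
        ennreal (1 / measure lborel P powr \<tau>) *
        lq_qnorm q {i..}
          (\<lambda>j. Lp_qnorm p P
            (\<lambda>x. \<Sum>\<^sub>\<infinity>Q\<in>{Q \<in> dyadic_cubes_at j. Q \<subseteq> P}. seq_term s t Q x)))"

definition f_space :: "real \<Rightarrow> real \<Rightarrow> real \<Rightarrow> ennreal \<Rightarrow> 'n::finite cube_seq set" where
  "f_space s \<tau> p q = {t. (\<forall>Q. Q \<notin> dyadic_cubes \<longrightarrow> t Q = 0) \<and> f_qnorm s \<tau> p q t < \<infinity>}"

definition b_space :: "real \<Rightarrow> real \<Rightarrow> ennreal \<Rightarrow> ennreal \<Rightarrow> 'n::finite cube_seq set" where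
  "b_space s \<tau> p q = {t. (\<forall>Q. Q \<notin> dyadic_cubes \<longrightarrow> t Q = 0) \<and> b_qnorm s \<tau> p q t < \<infinity>}"


section \<open>Proper linear subspaces\<close>

definition seq_scale :: "complex \<Rightarrow> 'n::finite cube_seq \<Rightarrow> 'n cube_seq" where
  "seq_scale c t = (\<lambda>Q. c * t Q)"

interpretation cube_seq: vector_space seq_scale
  by unfold_locales (auto simp: seq_scale_def fun_eq_iff algebra_simps)

definition proper_subspace :: "'n::finite cube_seq set \<Rightarrow> 'n cube_seq set \<Rightarrow> bool" where
  "proper_subspace U V \<longleftrightarrow> cube_seq.subspace U \<and> cube_seq.subspace V \<and> U \<subset> V"

end

theory Submission
  imports Defs
begin

text \<open>
  Write \<open>|t|\<^sub>Q = |Q|\<^bsup>-s/n-1/2\<^esup> |t Q|\<close> and \<open>\<sigma> = \<tau> + 1/q - 1/p \<le> 0\<close>. The inclusions follow from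
  Hoelder's inequality \<open>L\<^sup>q(P) \<rightarrow> L\<^sup>p(P)\<close>, which costs the factor \<open>|P|\<^bsup>1/p-1/q\<^esup>\<close>, and from Tonelli's
  theorem, which identifies the two types of quasi-norms when the two exponents agree.

  They are strict because of the sequence living on the cubes \<open>Q\<^sub>j = 2\<^bsup>-j\<^esup>[0,1)\<^sup>n\<close> with
  \<open>|t|\<^sub>Q = |Q|\<^bsup>\<tau>-1/p\<^esup>\<close>. The \<open>L\<^sup>r\<close> norm of its term of level \<open>j\<close> is \<open>|Q\<^sub>j|\<^bsup>\<tau>-1/p+1/r\<^esup>\<close>. For \<open>r = p\<close> this is
  \<open>|Q\<^sub>j|\<^sup>\<tau>\<close>, and the sum over \<open>Q\<^sub>j \<subseteq> P\<close> is geometric, of order \<open>|P|\<^sup>\<tau>\<close>; for \<open>r = q\<close> it is \<open>|Q\<^sub>j|\<^sup>\<sigma>\<close>, which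
  does not decay, so already \<open>P = [0,1)\<^sup>n\<close> gives an infinite quasi-norm. The Triebel-Lizorkin case
  is reduced to the Besov case by \<open>b\<^sub>p\<^sub>,\<^sub>p \<subseteq> f\<^sub>p\<^sub>,\<^sub>q\<close> for \<open>p < q\<close>.
\<close>

section \<open>Quasi-norms of nonnegative functions\<close>

lemma epowr_0 [simp]: "epowr 0 a = 0"
  by (simp add: epowr_def)

lemma epowr_top [simp]: "epowr top a = top"
  by (simp add: epowr_def infinity_ennreal_def)

lemma epowr_ennreal: "0 \<le> x \<Longrightarrow> epowr (ennreal x) a = ennreal (x powr a)"
  by (simp add: epowr_def)

lemma epowr_1 [simp]: "epowr x 1 = x"
  by (cases x) (auto simp: epowr_ennreal)

lemma epowr_mono: "0 \<le> a \<Longrightarrow> x \<le> y \<Longrightarrow> epowr x a \<le> epowr y a"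
  by (cases x; cases y) (auto simp: epowr_ennreal top_unique intro!: ennreal_leI powr_mono2)

lemma epowr_mult: "0 < a \<Longrightarrow> epowr (x * y) a = epowr x a * epowr y a"
  by (cases x; cases y)
    (auto simp: epowr_ennreal powr_mult ennreal_mult_top ennreal_top_mult
      simp flip: ennreal_mult)

lemma epowr_epowr: "epowr (epowr x a) b = epowr x (a * b)"
  by (cases x) (auto simp: epowr_ennreal powr_powr)

text \<open>The sum is at most twice the maximum. This crude bound treats exponents below and above
  1 alike.\<close>

lemma epowr_add_le:
  assumes "0 < a"
  shows "epowr (x + y) a \<le> ennreal (2 powr a) * (epowr x a + epowr y a)"
proof -
  have "epowr (x + y) a \<le> epowr (2 * max x y) a"
    by (intro epowr_mono) (use assms in \<open>auto simp: mult_2 add_mono\<close>)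
  also have "\<dots> = ennreal (2 powr a) * epowr (max x y) a"
    using epowr_ennreal[of 2 a] by (simp add: epowr_mult[OF assms])
  also have "\<dots> \<le> ennreal (2 powr a) * (epowr x a + epowr y a)"
    by (intro mult_left_mono) (auto simp: max_def)
  finally show ?thesis .
qed

lemma measurable_epowr [measurable]: "(\<lambda>x. epowr x a) \<in> borel_measurable borel"
  unfolding epowr_def by measurable

section \<open>Exponents in (0, infinity] and quasi-norms over a general measure\<close>

lemma exponent_cases:
  obtains "r = top" | e where "r = ennreal e" "0 \<le> e"
  by (cases r) auto

lemma recip_top [simp]: "recip top = 0"
  by (simp add: recip_def)

lemma recip_ennreal [simp]: "0 \<le> r \<Longrightarrow> recip (ennreal r) = 1 / r"
  by (simp add: recip_def)

lemma recip_nonneg: "0 \<le> recip r"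
  by (simp add: recip_def)

text \<open>Counting measure recovers \<open>lq_qnorm\<close> on countable index sets, and Lebesgue
  measure restricted to a Borel set recovers \<open>Lp_qnorm\<close>. Monotonicity, homogeneity and
  the quasi-triangle inequality are thus proved once for both.\<close>

definition qnorm :: "ennreal \<Rightarrow> 'a measure \<Rightarrow> ('a \<Rightarrow> ennreal) \<Rightarrow> ennreal" where
  "qnorm r M f =
     (if r = \<infinity> then esssup M f
      else epowr (\<integral>\<^sup>+x. epowr (f x) (enn2real r) \<partial>M) (recip r))"

lemma qnorm_top: "qnorm top M f = esssup M f"
  by (simp add: qnorm_def)

lemma qnorm_ennreal:
  "0 \<le> r \<Longrightarrow> qnorm (ennreal r) M f = epowr (\<integral>\<^sup>+x. epowr (f x) r \<partial>M) (1 / r)"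
  by (simp add: qnorm_def)

lemma epowr_qnorm:
  "0 < r \<Longrightarrow> epowr (qnorm (ennreal r) M f) r = (\<integral>\<^sup>+x. epowr (f x) r \<partial>M)"
  by (simp add: qnorm_ennreal epowr_epowr)

lemma epowr_le_iff:
  assumes "0 < a"
  shows "epowr x a \<le> epowr y a \<longleftrightarrow> x \<le> y"
proof
  assume "epowr x a \<le> epowr y a"
  then have "epowr (epowr x a) (1 / a) \<le> epowr (epowr y a) (1 / a)"
    by (rule epowr_mono[rotated]) (use assms in auto)
  then show "x \<le> y"
    using assms by (simp add: epowr_epowr)
qed (use assms in \<open>simp add: epowr_mono\<close>)

text \<open>Enumerating an infinite \<open>A\<close> turns the unordered sum into a series, which is
  an integral against counting measure on the naturals.\<close>

lemma infsum_ennreal_eq_nn_integral: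
  fixes f :: "'a \<Rightarrow> ennreal"
  assumes "countable A"
  shows "infsum f A = (\<integral>\<^sup>+x. f x \<partial>count_space A)"
proof (cases "finite A")
  case True
  then show ?thesis by (simp add: nn_integral_count_space_finite)
next
  case False
  define g where "g = from_nat_into A"
  have g: "bij_betw g UNIV A"
    unfolding g_def using assms False by (rule bij_betw_from_nat_into)
  have "infsum f A = (\<Sum>\<^sub>\<infinity>n. f (g n))"
    using infsum_reindex_bij_betw[OF g, of f] by simp
  also have "\<dots> = (\<Sum>n. f (g n))"
    by (intro sums_unique has_sum_imp_sums has_sum_infsum nonneg_summable_on_complete) auto
  also have "\<dots> = (\<integral>\<^sup>+n. f (g n) \<partial>count_space UNIV)"
    by (rule nn_integral_count_space_nat[symmetric])
  also have "\<dots> = (\<integral>\<^sup>+x. f x \<partial>count_space A)"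
    by (rule nn_integral_bij_count_space[OF g])
  finally show ?thesis .
qed

text \<open>Only the empty set is null for counting measure, so essential upper bounds are upper
  bounds.\<close>

lemma esssup_count_space:
  fixes f :: "'a \<Rightarrow> ennreal"
  shows "esssup (count_space A) f = (SUP x\<in>A. f x)"
  by (subst esssup_eq_AE) (auto simp: AE_count_space Sup_eq_Inf intro!: arg_cong[where f = Inf])

lemma lq_qnorm_eq_qnorm: "countable I \<Longrightarrow> lq_qnorm q I a = qnorm q (count_space I) a"
  by (simp add: lq_qnorm_def qnorm_def esssup_count_space infsum_ennreal_eq_nn_integral)

lemma Lp_qnorm_eq_qnorm:
  "P \<in> sets borel \<Longrightarrow> Lp_qnorm p P f = qnorm p (restrict_space lborel P) f"
  by (simp add: Lp_qnorm_def qnorm_def nn_integral_restrict_space)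

text \<open>Measurability of \<open>f\<close> enters for \<open>r = top\<close>, because
  \<open>esssup\<close> of a non-measurable function is \<open>top\<close> by default.\<close>

lemma qnorm_mono:
  assumes "AE x in M. f x \<le> g x" "f \<in> borel_measurable M"
  shows "qnorm r M f \<le> qnorm r M g"
proof (cases "r = top")
  case True
  with assms show ?thesis by (simp add: qnorm_top esssup_AE_mono)
next
  case False
  then show ?thesis using assms(1)
    by (auto simp: qnorm_def recip_nonneg intro!: epowr_mono nn_integral_mono_AE elim!: eventually_mono)
qed

lemma qnorm_cmult_le:
  assumes "0 < r" and f[measurable]: "f \<in> borel_measurable M"
  shows "qnorm r M (\<lambda>x. c * f x) \<le> c * qnorm r M f"
proof (cases r rule: exponent_cases)
  case 1
  have "AE x in M. c * f x \<le> c * esssup M f"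
    using esssup_AE[of f M] by eventually_elim (rule mult_left_mono, auto)
  then show ?thesis
    by (simp add: 1 qnorm_top esssup_I)
next
  case (2 e)
  with assms have e: "0 < e" by simp
  show ?thesis
    using e by (simp add: 2 qnorm_ennreal epowr_mult nn_integral_cmult epowr_epowr)
qed

text \<open>The constant depends on \<open>r\<close> alone and is fixed before the measure, so that
  it is later uniform over all cubes.\<close>

lemma qnorm_add_le:
  assumes "0 < r"
  obtains K :: real where "0 \<le> K"
    "\<And>(M :: 'a measure) f g. f \<in> borel_measurable M \<Longrightarrow> g \<in> borel_measurable M \<Longrightarrow>
       qnorm r M (\<lambda>x. f x + g x) \<le> ennreal K * (qnorm r M f + qnorm r M g)"
proof (cases r rule: exponent_cases)
  case 1
  show ?thesis
  proof (rule that[of 1])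
    fix M :: "'a measure" and f g :: "'a \<Rightarrow> ennreal"
    assume [measurable]: "f \<in> borel_measurable M" "g \<in> borel_measurable M"
    have "AE x in M. f x + g x \<le> esssup M f + esssup M g"
      using esssup_AE[of f M] esssup_AE[of g M] by eventually_elim (rule add_mono)
    then show "qnorm r M (\<lambda>x. f x + g x) \<le> ennreal 1 * (qnorm r M f + qnorm r M g)"
      by (simp add: 1 qnorm_top esssup_I)
  qed simp
next
  case (2 e)
  with assms have e: "0 < e" by simp
  \<comment> \<open>Splitting the power \<open>e\<close> under the integral costs
    \<open>2 powr e\<close>, which the outer root reduces to 2; splitting the outer root costs
    \<open>2 powr (1 / e)\<close>.\<close>
  define K where "K = 2 * 2 powr (1 / e)"
  show ?thesis
  proof (rule that[of K])
    fix M :: "'a measure" and f g :: "'a \<Rightarrow> ennreal"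
    assume [measurable]: "f \<in> borel_measurable M" "g \<in> borel_measurable M"
    let ?I = "\<lambda>f. \<integral>\<^sup>+x. epowr (f x) e \<partial>M"
    have "qnorm r M (\<lambda>x. f x + g x) = epowr (?I (\<lambda>x. f x + g x)) (1 / e)"
      using 2 by (simp add: qnorm_ennreal)
    also have "\<dots> \<le> epowr (\<integral>\<^sup>+x. ennreal (2 powr e) * (epowr (f x) e + epowr (g x) e) \<partial>M) (1 / e)"
      by (intro epowr_mono nn_integral_mono epowr_add_le) (use e in auto)
    also have "\<dots> = epowr (ennreal (2 powr e) * (?I f + ?I g)) (1 / e)"
      by (simp add: nn_integral_cmult nn_integral_add)
    also have "\<dots> = 2 * epowr (?I f + ?I g) (1 / e)"
      using e by (simp add: epowr_mult epowr_ennreal powr_powr)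
    also have "\<dots> \<le> 2 * (ennreal (2 powr (1 / e)) * (epowr (?I f) (1 / e) + epowr (?I g) (1 / e)))"
      by (intro mult_left_mono epowr_add_le) (use e in auto)
    also have "\<dots> = ennreal K * (qnorm r M f + qnorm r M g)"
      using 2 by (simp add: K_def qnorm_ennreal ennreal_mult mult.assoc)
    finally show "qnorm r M (\<lambda>x. f x + g x) \<le> ennreal K * (qnorm r M f + qnorm r M g)" .
  qed (simp add: K_def)
qed

lemma epowr_add: "epowr x (a + b) = epowr x a * epowr x b"
  by (cases x) (auto simp: epowr_ennreal powr_add ennreal_mult ennreal_top_mult)

section \<open>Interchanging two quasi-norms and comparing exponents\<close>

lemma measurable_qnorm_count_space:
  fixes S :: "'i \<Rightarrow> 'a \<Rightarrow> ennreal"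
  assumes "countable I" and [measurable]: "\<And>j. S j \<in> borel_measurable M"
  shows "(\<lambda>x. qnorm q (count_space I) (\<lambda>j. S j x)) \<in> borel_measurable M"
proof (cases q rule: exponent_cases)
  case 1
  then show ?thesis
    using assms(1) by (simp add: qnorm_top esssup_count_space borel_measurable_SUP)
next
  case (2 e)
  interpret sigma_finite_measure "count_space I"
    using assms(1) by (rule sigma_finite_measure_count_space_countable)
  \<comment> \<open>A countable family of measurable functions is jointly measurable, so integrating
    out the index leaves a measurable function.\<close>
  have "(\<lambda>(j, x). epowr (S j x) e) \<in> borel_measurable (count_space I \<Otimes>\<^sub>M M)"
    by (rule measurable_pair_measure_countable1[OF assms(1)]) simp
  then have [measurable]: "(\<lambda>(x, j). epowr (S j x) e) \<in> borel_measurable (M \<Otimes>\<^sub>M count_space I)"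
    by (subst measurable_pair_swap_iff) (simp add: split_beta)
  show ?thesis
    using 2 by (simp add: qnorm_ennreal)
qed

text \<open>For finite \<open>q\<close> both sides are iterated integrals of the same
  \<open>q\<close>-th power and Tonelli applies. For \<open>q = top\<close> the countably many
  exceptional null sets, one for each index, are combined into one.\<close>

lemma qnorm_swap_le:
  fixes S :: "'i \<Rightarrow> 'a \<Rightarrow> ennreal"
  assumes q: "0 < q" and I: "countable I" and M: "sigma_finite_measure M"
    and S[measurable]: "\<And>j. S j \<in> borel_measurable M"
  shows "qnorm q M (\<lambda>x. qnorm q (count_space I) (\<lambda>j. S j x))
      \<le> qnorm q (count_space I) (\<lambda>j. qnorm q M (S j))"
proof (cases q rule: exponent_cases)
  case 1
  have "AE x in M. \<forall>j\<in>I. S j x \<le> esssup M (S j)"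
    unfolding AE_ball_countable[OF I] by (intro ballI esssup_AE)
  then have "AE x in M. (SUP j\<in>I. S j x) \<le> (SUP j\<in>I. esssup M (S j))"
    by eventually_elim (auto intro!: SUP_mono)
  moreover have "(\<lambda>x. SUP j\<in>I. S j x) \<in> borel_measurable M"
    using I by (simp add: borel_measurable_SUP)
  ultimately show ?thesis
    unfolding 1 qnorm_top esssup_count_space by (intro esssup_I)
next
  case (2 e)
  with q have e: "0 < e" by simp
  interpret pair_sigma_finite "count_space I" M
    using M I by (simp add: pair_sigma_finite_def sigma_finite_measure_count_space_countable)
  have "(\<lambda>(j, x). epowr (S j x) e) \<in> borel_measurable (count_space I \<Otimes>\<^sub>M M)"
    by (rule measurable_pair_measure_countable1[OF I]) simp
  from Fubini'[OF this]
  show ?thesis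
    using e by (simp add: 2 qnorm_ennreal epowr_epowr)
qed

text \<open>Every term is at most the norm \<open>?B\<close> with exponent \<open>p\<close>, hence
  its power \<open>e\<close> is at most its power \<open>p\<close> times
  \<open>epowr ?B (e - p)\<close>, and summation gives the claim.\<close>

lemma qnorm_count_space_antimono_exponent:
  assumes p: "0 < p" and pq: "ennreal p < q"
  shows "qnorm q (count_space I) a \<le> qnorm (ennreal p) (count_space I) a" (is "_ \<le> ?B")
proof -
  have le: "a j \<le> ?B" if "j \<in> I" for j
  proof -
    have "epowr (a j) p \<le> epowr ?B p"
      using nn_integral_ge_point[OF that, of "\<lambda>j. epowr (a j) p"] p by (simp add: epowr_qnorm)
    then show ?thesis using p by (simp add: epowr_le_iff)
  qed
  show ?thesis
  proof (cases q rule: exponent_cases)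
    case 1
    then show ?thesis
      by (simp only: qnorm_top esssup_count_space) (intro SUP_least le)
  next
    case (2 e)
    with p pq have e: "0 < e" "p < e" by (auto simp: ennreal_less_iff)
    have "(\<integral>\<^sup>+j. epowr (a j) e \<partial>count_space I)
        \<le> (\<integral>\<^sup>+j. epowr (a j) p * epowr ?B (e - p) \<partial>count_space I)"
    proof (rule nn_integral_mono)
      fix j assume "j \<in> space (count_space I)"
      then have "epowr (a j) p * epowr (a j) (e - p) \<le> epowr (a j) p * epowr ?B (e - p)"
        by (intro mult_left_mono epowr_mono le) (use e in auto)
      then show "epowr (a j) e \<le> epowr (a j) p * epowr ?B (e - p)"
        by (simp flip: epowr_add)
    qed
    also have "\<dots> = epowr ?B p * epowr ?B (e - p)"
      using p by (simp add: nn_integral_multc epowr_qnorm)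
    also have "\<dots> = epowr ?B e"
      by (simp flip: epowr_add)
    also have "(\<integral>\<^sup>+j. epowr (a j) e \<partial>count_space I) = epowr (qnorm q (count_space I) a) e"
      using e by (simp add: 2 epowr_qnorm)
    finally show ?thesis
      using e by (simp add: epowr_le_iff)
  qed
qed

text \<open>
  Integrated with \<open>A\<^sup>e\<close> equal to the mean of \<open>y\<^sup>e\<close>, this bound gives Hoelder's inequality up to the
  constant \<open>2\<^bsup>1/p\<^esup>\<close>, which is all that is needed here.
\<close>

lemma epowr_le_threshold:
  assumes A: "0 < A" and pe: "0 < p" "p < e"
  shows "epowr y p \<le> ennreal (A powr p) + ennreal (A powr (p - e)) * epowr y e"
proof (cases "y \<le> ennreal A")
  case True
  then have "epowr y p \<le> epowr (ennreal A) p"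
    using pe by (intro epowr_mono) auto
  then show ?thesis
    using A by (simp add: epowr_ennreal add_increasing2)
next
  case False
  show ?thesis
  proof (cases y)
    case (real r)
    with False A have r: "A < r" by (simp add: ennreal_less_iff not_le)
    \<comment> \<open>The exponent \<open>p - e\<close> is negative, so replacing \<open>r\<close>
      by the smaller \<open>A\<close> increases that factor.\<close>
    have "r powr p = r powr (p - e) * r powr e"
      by (simp flip: powr_add)
    also have "\<dots> \<le> A powr (p - e) * r powr e"
      using r A pe by (intro mult_right_mono powr_mono2') auto
    also have "\<dots> \<le> A powr p + A powr (p - e) * r powr e"
      by simp
    finally show ?thesis
      using real A by (simp add: epowr_ennreal ennreal_leI flip: ennreal_mult ennreal_plus)
  qed (use A in \<open>simp add: ennreal_mult_top\<close>)
qed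

lemma qnorm_mono_exponent:
  assumes p: "0 < p" and pq: "ennreal p < q" and m: "emeasure M (space M) = ennreal m" "0 < m"
    and f[measurable]: "f \<in> borel_measurable M"
  shows "qnorm (ennreal p) M f
      \<le> ennreal (2 powr (1 / p) * m powr (1 / p - recip q)) * qnorm q M f"
proof (cases q rule: exponent_cases)
  case 1
  have "qnorm (ennreal p) M f \<le> qnorm (ennreal p) M (\<lambda>x. esssup M f)"
    by (rule qnorm_mono[OF esssup_AE f])
  also have "\<dots> = ennreal (m powr (1 / p)) * esssup M f"
    using p m by (simp add: qnorm_ennreal epowr_mult epowr_epowr epowr_ennreal mult.commute)
  also have "\<dots> \<le> ennreal (2 powr (1 / p) * m powr (1 / p)) * esssup M f"
    using p by (intro mult_right_mono ennreal_leI) (auto simp: mult_le_cancel_right1 ge_one_powr_ge_zero)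
  finally show ?thesis
    using 1 by (simp add: qnorm_top)
next
  case (2 e)
  with p pq have e: "0 < e" "p < e" by (auto simp: ennreal_less_iff)
  \<comment> \<open>If the right-hand norm is infinite, the positive constant makes the claim
    trivial. The value \<open>b = 0\<close> is separated because the threshold \<open>A\<close> must
    be positive.\<close>
  show ?thesis
  proof (cases "qnorm q M f")
    case (real b)
    have int: "(\<integral>\<^sup>+x. epowr (f x) e \<partial>M) = ennreal (b powr e)"
      using epowr_qnorm[OF e(1), of M f] real by (simp add: 2 epowr_ennreal)
    show ?thesis
    proof (cases "b = 0")
      case True
      with int have "AE x in M. epowr (f x) e \<le> epowr 0 e"
        by (simp add: nn_integral_0_iff_AE)
      then have "AE x in M. f x \<le> 0"
        unfolding epowr_le_iff[OF e(1)] .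
      then have "qnorm (ennreal p) M f \<le> qnorm (ennreal p) M (\<lambda>x. 0)"
        by (intro qnorm_mono) auto
      then show ?thesis
        using p by (simp add: qnorm_ennreal)
    next
      case False
      with real have b: "0 < b" by simp
      \<comment> \<open>This choice makes both terms of the integrated threshold bound equal to
        \<open>A powr p * m\<close>, whence the factor 2.\<close>
      define A where "A = b * m powr (- 1 / e)"
      have A: "0 < A" using b m by (simp add: A_def)
      have "(\<integral>\<^sup>+x. epowr (f x) p \<partial>M)
          \<le> (\<integral>\<^sup>+x. ennreal (A powr p) + ennreal (A powr (p - e)) * epowr (f x) e \<partial>M)"
        by (intro nn_integral_mono epowr_le_threshold A p e)
      also have "\<dots> = ennreal (A powr p * m + A powr (p - e) * b powr e)"
        using m by (simp add: nn_integral_add nn_integral_cmult int ennreal_mult)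
      also have "A powr (p - e) * b powr e = A powr p * m"
        using b m e by (simp add: A_def powr_mult powr_divide powr_powr powr_diff field_simps powr_minus)
      finally have "(\<integral>\<^sup>+x. epowr (f x) p \<partial>M) \<le> ennreal (2 * (A powr p * m))"
        by (simp add: mult.commute)
      then have "qnorm (ennreal p) M f \<le> epowr (ennreal (2 * (A powr p * m))) (1 / p)"
        using p by (simp add: qnorm_ennreal epowr_mono)
      also have "\<dots> = ennreal (2 powr (1 / p) * (A * m powr (1 / p)))"
        using A p m by (simp add: epowr_ennreal powr_mult powr_powr)
      also have "A * m powr (1 / p) = m powr (1 / p - recip q) * b"
        using e by (simp add: A_def 2 mult_ac flip: powr_add)
      finally show ?thesis
        using real by (simp add: ennreal_mult mult.assoc)
    qed
  qed (use m in \<open>simp add: ennreal_mult_top\<close>)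
qed

section \<open>Dyadic cubes\<close>

text \<open>Rescaling by \<open>2 powi j\<close> turns the half-open conditions into the
  characterization of the floor. It follows that the cubes of one level partition the space, with
  \<open>cube_at j x\<close> the one through \<open>x\<close>.\<close>

lemma dyadic_cube_mem_iff:
  "x \<in> dyadic_cube j k \<longleftrightarrow> k = (\<chi> i. \<lfloor>2 powi j * x $ i\<rfloor>)"
proof -
  have "(2 powi (- j) * real_of_int a \<le> y \<and> y < 2 powi (- j) * (real_of_int a + 1)) \<longleftrightarrow>
      a = \<lfloor>2 powi j * y\<rfloor>" for a :: int and y :: real
  proof -
    have "2 powi (- j) * real_of_int a \<le> y \<longleftrightarrow> real_of_int a \<le> 2 powi j * y"
      "y < 2 powi (- j) * (real_of_int a + 1) \<longleftrightarrow> 2 powi j * y < real_of_int a + 1"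
      by (simp_all add: power_int_minus field_simps)
    then show ?thesis by (auto simp: floor_unique eq_commute[of a] floor_eq_iff)
  qed
  then show ?thesis
    by (auto simp: dyadic_cube_def vec_eq_iff)
qed

definition cube_at :: "int \<Rightarrow> real ^ 'n \<Rightarrow> (real ^ 'n) set" where
  "cube_at j x = dyadic_cube j (\<chi> i. \<lfloor>2 powi j * x $ i\<rfloor>)"

lemma cube_at_mem: "x \<in> cube_at j x"
  by (simp add: cube_at_def dyadic_cube_mem_iff)

lemma cube_at_in_dyadic_cubes_at: "cube_at j x \<in> dyadic_cubes_at j"
  by (simp add: cube_at_def dyadic_cubes_at_def)

lemma dyadic_cubes_at_unique: "Q \<in> dyadic_cubes_at j \<Longrightarrow> x \<in> Q \<Longrightarrow> Q = cube_at j x"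
  by (auto simp: cube_at_def dyadic_cubes_at_def dyadic_cube_mem_iff)

lemma countable_dyadic_cubes_at: "countable (dyadic_cubes_at j)"
  by (simp add: dyadic_cubes_at_def)

lemma countable_dyadic_cubes: "countable dyadic_cubes"
  by (simp add: dyadic_cubes_def countable_dyadic_cubes_at)

lemma dyadic_cube_measurable [measurable]: "dyadic_cube j k \<in> sets borel"
  unfolding dyadic_cube_def by measurable

text \<open>The half-open cube is squeezed between an open and a closed box of the same
  measure.\<close>

lemma emeasure_dyadic_cube:
  fixes k :: "int ^ 'n"
  shows "emeasure lborel (dyadic_cube j k) = ennreal (2 powr (- real CARD('n) * real_of_int j))"
proof -
  define c where "c = (2::real) powi (- j)"
  have c: "0 < c" by (simp add: c_def)
  have c': "c = 2 powr (- real_of_int j)"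
    using powr_real_of_int'[of 2 "- j"] by (simp add: c_def)
  define a b where "a = (\<chi> i. c * real_of_int (k $ i))" and "b = (\<chi> i. c * (real_of_int (k $ i) + 1))"
  have le: "a \<bullet> i \<le> b \<bullet> i" if "i \<in> Basis" for i
    using that c by (auto simp: Basis_vec_def a_def b_def inner_axis algebra_simps)
  have "(\<Prod>i\<in>Basis. (b - a) \<bullet> i) = (\<Prod>i\<in>(Basis :: (real ^ 'n) set). c)"
    by (intro prod.cong) (auto simp: Basis_vec_def a_def b_def inner_axis algebra_simps)
  also have "\<dots> = 2 powr (- real CARD('n) * real_of_int j)"
    by (simp add: c' powr_realpow[symmetric] powr_powr mult.commute)
  finally have prod: "(\<Prod>i\<in>Basis. (b - a) \<bullet> i) = 2 powr (- real CARD('n) * real_of_int j)" .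
  have "box a b \<subseteq> dyadic_cube j k" "dyadic_cube j k \<subseteq> cbox a b"
    by (auto simp: dyadic_cube_def mem_box_cart a_def b_def c_def less_imp_le)
  then have "emeasure lborel (box a b) \<le> emeasure lborel (dyadic_cube j k)"
    "emeasure lborel (dyadic_cube j k) \<le> emeasure lborel (cbox a b)"
    by (auto intro!: emeasure_mono)
  then show ?thesis
    using le prod by (simp add: emeasure_lborel_box emeasure_lborel_cbox)
qed

lemma dyadic_cubes_atD:
  fixes Q :: "(real ^ 'n) set"
  assumes "Q \<in> dyadic_cubes_at j"
  shows "Q \<in> sets borel"
    "emeasure lborel Q = ennreal (2 powr (- real CARD('n) * real_of_int j))"
    "measure lborel Q = 2 powr (- real CARD('n) * real_of_int j)"
  using assms by (auto simp: dyadic_cubes_at_def emeasure_dyadic_cube measure_def)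

text \<open>The measure of a cube is strictly decreasing in its level, so monotonicity of the
  measure suffices.\<close>

lemma dyadic_cubes_at_subset_level:
  fixes P Q :: "(real ^ 'n) set"
  assumes "P \<in> dyadic_cubes_at i" "Q \<in> dyadic_cubes_at j" "Q \<subseteq> P"
  shows "i \<le> j"
proof -
  have "emeasure lborel Q \<le> emeasure lborel P"
    using assms dyadic_cubes_atD by (intro emeasure_mono) auto
  then show ?thesis
    using assms by (simp add: dyadic_cubes_atD)
qed

lemma dyadic_cubes_at_disjoint_levels:
  fixes Q :: "(real ^ 'n) set"
  shows "Q \<in> dyadic_cubes_at i \<Longrightarrow> Q \<in> dyadic_cubes_at j \<Longrightarrow> i = j"
  using dyadic_cubes_at_subset_level[of Q i Q j] dyadic_cubes_at_subset_level[of Q j Q i] by simp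

section \<open>The contribution of a single level\<close>

definition level_term :: "real \<Rightarrow> 'n::finite cube_seq \<Rightarrow> (real ^ 'n) set \<Rightarrow> int \<Rightarrow> real ^ 'n \<Rightarrow> ennreal" where
  "level_term s t P j x = (\<Sum>\<^sub>\<infinity>Q\<in>{Q \<in> dyadic_cubes_at j. Q \<subseteq> P}. seq_term s t Q x)"

lemma seq_term_outside: "x \<notin> Q \<Longrightarrow> seq_term s t Q x = 0"
  by (simp add: seq_term_def)

text \<open>Among the cubes of level \<open>j\<close> only the one through \<open>x\<close> can
  contribute, so the sum has at most one nonzero term.\<close>

lemma level_term_eq:
  "level_term s t P j x = (if cube_at j x \<subseteq> P then seq_term s t (cube_at j x) x else 0)"
proof -
  have "level_term s t P j x
      = (\<Sum>\<^sub>\<infinity>Q\<in>(if cube_at j x \<subseteq> P then {cube_at j x} else {}). seq_term s t Q x)"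
    unfolding level_term_def
  proof (rule infsum_cong_neutral)
    fix Q assume "Q \<in> {Q \<in> dyadic_cubes_at j. Q \<subseteq> P} - (if cube_at j x \<subseteq> P then {cube_at j x} else {})"
    then show "seq_term s t Q x = 0"
      by (intro seq_term_outside) (auto dest: dyadic_cubes_at_unique split: if_splits)
  qed (use cube_at_in_dyadic_cubes_at in \<open>auto split: if_splits\<close>)
  then show ?thesis by simp
qed

lemma measurable_level_term [measurable]: "level_term s t P j \<in> borel_measurable borel"
proof -
  let ?I = "{Q \<in> dyadic_cubes_at j. Q \<subseteq> P}"
  have I: "countable ?I"
    by (rule countable_subset[OF _ countable_dyadic_cubes_at]) auto
  \<comment> \<open>The measurability lemma asks for every index, including non-measurable sets
    \<open>Q\<close>; the terms are therefore cut off outside \<open>?I\<close>.\<close>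
  have m: "(\<lambda>x. if Q \<in> ?I then seq_term s t Q x else 0) \<in> borel_measurable borel" for Q
  proof (cases "Q \<in> ?I")
    case True
    then have [measurable]: "Q \<in> sets borel" by (auto dest: dyadic_cubes_atD)
    show ?thesis unfolding seq_term_def by measurable
  qed (simp only: if_False borel_measurable_const)
  have "level_term s t P j
      = (\<lambda>x. qnorm (ennreal 1) (count_space ?I) (\<lambda>Q. if Q \<in> ?I then seq_term s t Q x else 0))"
    by (intro ext) (auto simp: level_term_def infsum_ennreal_eq_nn_integral[OF I] qnorm_ennreal
        simp del: ennreal_1 intro!: nn_integral_cong)
  also have "\<dots> \<in> borel_measurable borel"
    by (rule measurable_qnorm_count_space[OF I m])
  finally show ?thesis .
qed

text \<open>
  Each point lies in exactly one cube of each level, so a sum or supremum over all cubes reduces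
  to one over levels.
\<close>

lemma qnorm_count_space_subcubes:
  fixes P :: "(real ^ 'n) set"
  assumes P: "P \<in> dyadic_cubes_at i" and q: "0 < q"
  shows "qnorm q (count_space {Q \<in> dyadic_cubes. Q \<subseteq> P}) (\<lambda>Q. seq_term s t Q x)
       = qnorm q (count_space {i..}) (\<lambda>j. level_term s t P j x)"
proof -
  \<comment> \<open>\<open>?J\<close> collects the levels whose cube through \<open>x\<close> stays
    inside \<open>P\<close>. It embeds into \<open>?A\<close>, and all subcubes outside its image
    vanish at \<open>x\<close>.\<close>
  let ?A = "{Q \<in> dyadic_cubes. Q \<subseteq> P}" and ?J = "{j. cube_at j x \<subseteq> P}"
  have sub: "(\<lambda>j. cube_at j x) ` ?J \<subseteq> ?A"
    using cube_at_in_dyadic_cubes_at by (auto simp: dyadic_cubes_def)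
  have J: "?J \<subseteq> {i..}"
    using dyadic_cubes_at_subset_level[OF P cube_at_in_dyadic_cubes_at] by auto
  have out: "seq_term s t Q x = 0" if "Q \<in> ?A - (\<lambda>j. cube_at j x) ` ?J" for Q
    using that by (intro seq_term_outside) (auto simp: dyadic_cubes_def dest: dyadic_cubes_at_unique)
  have inj: "inj_on (\<lambda>j. cube_at j x) ?J"
    by (intro inj_onI) (metis cube_at_in_dyadic_cubes_at dyadic_cubes_at_disjoint_levels)
  show ?thesis
  proof (cases q rule: exponent_cases)
    case 1
    have "(SUP Q\<in>?A. seq_term s t Q x) = (SUP j\<in>{i..}. level_term s t P j x)"
    proof (rule antisym; rule SUP_least)
      fix Q assume Q: "Q \<in> ?A"
      show "seq_term s t Q x \<le> (SUP j\<in>{i..}. level_term s t P j x)"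
      proof (cases "Q \<in> (\<lambda>j. cube_at j x) ` ?J")
        case True
        then obtain j where j: "j \<in> ?J" "Q = cube_at j x" by auto
        with J have "j \<in> {i..}" by auto
        with j show ?thesis
          by (intro SUP_upper2[of j]) (auto simp: level_term_eq)
      qed (use out Q in auto)
    next
      fix j assume "j \<in> {i..}"
      show "level_term s t P j x \<le> (SUP Q\<in>?A. seq_term s t Q x)"
        using sub by (auto simp: level_term_eq intro!: SUP_upper)
    qed
    then show ?thesis
      by (simp add: 1 qnorm_top esssup_count_space)
  next
    case (2 e)
    have "(\<integral>\<^sup>+Q. epowr (seq_term s t Q x) e \<partial>count_space ?A)
        = (\<integral>\<^sup>+Q. epowr (seq_term s t Q x) e \<partial>count_space ((\<lambda>j. cube_at j x) ` ?J))"
      using sub out by (intro nn_integral_count_space_eq) auto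
    also have "\<dots> = (\<integral>\<^sup>+j. epowr (seq_term s t (cube_at j x) x) e \<partial>count_space ?J)"
      using nn_integral_bij_count_space[OF inj_on_imp_bij_betw[OF inj],
        of "\<lambda>Q. epowr (seq_term s t Q x) e"] by simp
    also have "\<dots> = (\<integral>\<^sup>+j. epowr (level_term s t P j x) e \<partial>count_space ?J)"
      by (intro nn_integral_cong) (simp add: level_term_eq)
    also have "\<dots> = (\<integral>\<^sup>+j. epowr (level_term s t P j x) e \<partial>count_space {i..})"
      using J by (intro nn_integral_count_space_eq) (auto simp: level_term_eq)
    finally show ?thesis
      using 2 by (simp add: qnorm_ennreal)
  qed
qed

section \<open>Local quasi-norms and inclusions\<close>

text \<open>Unlike in \<open>f_qnorm\<close>, the exponent \<open>p\<close> may be infinite here, so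
  that the diagonal case \<open>p = q\<close> makes sense for \<open>q = top\<close> as
  well.\<close>

definition f_local :: "real \<Rightarrow> ennreal \<Rightarrow> ennreal \<Rightarrow> 'n::finite cube_seq \<Rightarrow> int \<Rightarrow> (real ^ 'n) set \<Rightarrow> ennreal" where
  "f_local s p q t i P = qnorm p (restrict_space lborel P)
     (\<lambda>x. qnorm q (count_space {i..}) (\<lambda>j. level_term s t P j x))"

definition b_local :: "real \<Rightarrow> ennreal \<Rightarrow> ennreal \<Rightarrow> 'n::finite cube_seq \<Rightarrow> int \<Rightarrow> (real ^ 'n) set \<Rightarrow> ennreal" where
  "b_local s p q t i P = qnorm q (count_space {i..})
     (\<lambda>j. qnorm p (restrict_space lborel P) (level_term s t P j))"

text \<open>The outer supremum shared by both scales. The level is passed to \<open>L\<close>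
  because the local quasi-norms start at the level of \<open>P\<close>.\<close>

definition cube_sup :: "real \<Rightarrow> (int \<Rightarrow> (real ^ 'n::finite) set \<Rightarrow> ennreal) \<Rightarrow> ennreal" where
  "cube_sup \<tau> L = (SUP i. SUP P\<in>dyadic_cubes_at i. ennreal (1 / measure lborel P powr \<tau>) * L i P)"

lemma b_qnorm_eq: "b_qnorm s \<tau> p q t = cube_sup \<tau> (b_local s p q t)"
  unfolding b_qnorm_def cube_sup_def b_local_def
  by (intro SUP_cong refl arg_cong2[where f = "(*)"])
    (simp add: lq_qnorm_eq_qnorm Lp_qnorm_eq_qnorm dyadic_cubes_atD level_term_def[abs_def])

lemma f_qnorm_eq:
  assumes "0 < q"
  shows "f_qnorm s \<tau> p q t = cube_sup \<tau> (f_local s (ennreal p) q t)"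
proof -
  have "f_qnorm s \<tau> p q t = (SUP i. SUP P\<in>dyadic_cubes_at i.
        ennreal (1 / measure lborel P powr \<tau>) *
        Lp_qnorm (ennreal p) P
          (\<lambda>x. lq_qnorm q {Q \<in> dyadic_cubes. Q \<subseteq> P} (\<lambda>Q. seq_term s t Q x)))"
    unfolding f_qnorm_def dyadic_cubes_def by (rule SUP_UNION)
  also have "\<dots> = cube_sup \<tau> (f_local s (ennreal p) q t)"
    unfolding cube_sup_def f_local_def
  proof (intro SUP_cong refl arg_cong2[where f = "(*)"])
    fix i :: int and P :: "(real ^ 'a) set"
    assume P: "P \<in> dyadic_cubes_at i"
    have "countable {Q \<in> dyadic_cubes. Q \<subseteq> P}"
      by (rule countable_subset[OF _ countable_dyadic_cubes]) auto
    then show "Lp_qnorm (ennreal p) P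
        (\<lambda>x. lq_qnorm q {Q \<in> dyadic_cubes. Q \<subseteq> P} (\<lambda>Q. seq_term s t Q x)) =
      qnorm (ennreal p) (restrict_space lborel P)
        (\<lambda>x. qnorm q (count_space {i..}) (\<lambda>j. level_term s t P j x))"
      using dyadic_cubes_atD(1)[OF P]
      by (simp add: lq_qnorm_eq_qnorm Lp_qnorm_eq_qnorm qnorm_count_space_subcubes[OF P assms])
  qed
  finally show ?thesis .
qed

lemma cube_sup_le:
  assumes "\<And>i P. P \<in> dyadic_cubes_at i \<Longrightarrow> L i P \<le> ennreal (measure lborel P powr \<tau>) * C"
  shows "cube_sup \<tau> L \<le> C"
  unfolding cube_sup_def
proof (intro SUP_least)
  fix i :: int and P :: "(real ^ 'a) set"
  assume P: "P \<in> dyadic_cubes_at i"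
  have "ennreal (1 / measure lborel P powr \<tau>) * L i P
      \<le> ennreal (1 / measure lborel P powr \<tau>) * (ennreal (measure lborel P powr \<tau>) * C)"
    by (intro mult_left_mono assms P) simp
  also have "\<dots> = ennreal (1 / measure lborel P powr \<tau> * measure lborel P powr \<tau>) * C"
    by (subst ennreal_mult) (auto simp: mult.assoc)
  also have "\<dots> = C"
    using P by (simp add: dyadic_cubes_atD)
  finally show "ennreal (1 / measure lborel P powr \<tau>) * L i P \<le> C" .
qed

lemma le_cube_sup:
  fixes P :: "(real ^ 'n::finite) set"
  assumes "P \<in> dyadic_cubes_at i"
  shows "L i P \<le> ennreal (measure lborel P powr \<tau>) * cube_sup \<tau> L"
proof -
  have "L i P = ennreal (measure lborel P powr \<tau> * (1 / measure lborel P powr \<tau>)) * L i P"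
    using assms by (simp add: dyadic_cubes_atD)
  also have "\<dots> = ennreal (measure lborel P powr \<tau>) * (ennreal (1 / measure lborel P powr \<tau>) * L i P)"
    by (subst ennreal_mult) (auto simp: mult.assoc)
  also have "\<dots> \<le> ennreal (measure lborel P powr \<tau>) * cube_sup \<tau> L"
    unfolding cube_sup_def using assms
    by (intro mult_left_mono SUP_upper2[of i] SUP_upper2[of P]) auto
  finally show ?thesis .
qed

section \<open>Closure under linear operations\<close>

lemma subspace_cube_sup_finite:
  fixes L :: "'n::finite cube_seq \<Rightarrow> int \<Rightarrow> (real ^ 'n) set \<Rightarrow> ennreal" and K :: real
  assumes add: "\<And>t u i P. P \<in> dyadic_cubes_at i \<Longrightarrow> L (t + u) i P \<le> ennreal K * (L t i P + L u i P)"
    and scale: "\<And>c t i P. P \<in> dyadic_cubes_at i \<Longrightarrow> L (seq_scale c t) i P \<le> ennreal (cmod c) * L t i P"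
  shows "cube_seq.subspace {t. (\<forall>Q. Q \<notin> dyadic_cubes \<longrightarrow> t Q = 0) \<and> cube_sup \<tau> (L t) < \<infinity>}"
proof -
  \<comment> \<open>Since \<open>K\<close> is the same for all cubes, it passes through the weighted
    supremum.\<close>
  have add': "cube_sup \<tau> (L (t + u)) \<le> ennreal K * (cube_sup \<tau> (L t) + cube_sup \<tau> (L u))" for t u
  proof (rule cube_sup_le)
    fix i :: int and P :: "(real ^ 'n) set"
    assume P: "P \<in> dyadic_cubes_at i"
    have "L (t + u) i P \<le> ennreal K * (L t i P + L u i P)"
      by (rule add[OF P])
    also have "\<dots> \<le> ennreal K * (ennreal (measure lborel P powr \<tau>) * cube_sup \<tau> (L t)
        + ennreal (measure lborel P powr \<tau>) * cube_sup \<tau> (L u))"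
      by (intro mult_left_mono add_mono le_cube_sup P) simp
    finally show "L (t + u) i P
        \<le> ennreal (measure lborel P powr \<tau>) * (ennreal K * (cube_sup \<tau> (L t) + cube_sup \<tau> (L u)))"
      by (simp add: algebra_simps)
  qed
  have scale': "cube_sup \<tau> (L (seq_scale c t)) \<le> ennreal (cmod c) * cube_sup \<tau> (L t)" for c t
  proof (rule cube_sup_le)
    fix i :: int and P :: "(real ^ 'n) set"
    assume P: "P \<in> dyadic_cubes_at i"
    have "L (seq_scale c t) i P \<le> ennreal (cmod c) * L t i P"
      by (rule scale[OF P])
    also have "\<dots> \<le> ennreal (cmod c) * (ennreal (measure lborel P powr \<tau>) * cube_sup \<tau> (L t))"
      by (intro mult_left_mono le_cube_sup P) simp
    finally show "L (seq_scale c t) i P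
        \<le> ennreal (measure lborel P powr \<tau>) * (ennreal (cmod c) * cube_sup \<tau> (L t))"
      by (simp add: algebra_simps)
  qed
  \<comment> \<open>Scaling by 0 suffices, because \<open>0 * x = 0\<close> in
    \<open>ennreal\<close> even for infinite \<open>x\<close>.\<close>
  have zero: "cube_sup \<tau> (L 0) = 0"
    using scale'[of 0 0] by (simp add: seq_scale_def zero_fun_def)
  show ?thesis
    unfolding cube_seq.subspace_def
  proof (intro conjI ballI allI)
    fix t u :: "'n cube_seq"
    assume "t \<in> {t. (\<forall>Q. Q \<notin> dyadic_cubes \<longrightarrow> t Q = 0) \<and> cube_sup \<tau> (L t) < \<infinity>}"
      "u \<in> {t. (\<forall>Q. Q \<notin> dyadic_cubes \<longrightarrow> t Q = 0) \<and> cube_sup \<tau> (L t) < \<infinity>}"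
    then show "t + u \<in> {t. (\<forall>Q. Q \<notin> dyadic_cubes \<longrightarrow> t Q = 0) \<and> cube_sup \<tau> (L t) < \<infinity>}"
      using add'[of t u] by (auto intro: le_less_trans simp: ennreal_mult_less_top)
  next
    fix t :: "'n cube_seq" and c
    assume "t \<in> {t. (\<forall>Q. Q \<notin> dyadic_cubes \<longrightarrow> t Q = 0) \<and> cube_sup \<tau> (L t) < \<infinity>}"
    then show "seq_scale c t \<in> {t. (\<forall>Q. Q \<notin> dyadic_cubes \<longrightarrow> t Q = 0) \<and> cube_sup \<tau> (L t) < \<infinity>}"
      using scale'[of c t] by (auto intro: le_less_trans simp: ennreal_mult_less_top seq_scale_def)
  qed (simp add: zero)
qed

lemma level_term_add_le: "level_term s (t + u) P j x \<le> level_term s t P j x + level_term s u P j x"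
proof -
  have "seq_term s (t + u) Q x \<le> seq_term s t Q x + seq_term s u Q x" for Q
    by (auto simp: seq_term_def simp flip: ennreal_plus distrib_left distrib_right
        intro!: ennreal_leI mult_right_mono mult_left_mono norm_triangle_ineq)
  then show ?thesis by (simp add: level_term_eq)
qed

lemma level_term_scale: "level_term s (seq_scale c t) P j x = ennreal (cmod c) * level_term s t P j x"
  by (auto simp: level_term_eq seq_term_def seq_scale_def norm_mult mult_ac simp flip: ennreal_mult)

lemma measurable_level_term_restrict [measurable]:
  "level_term s t P j \<in> borel_measurable (restrict_space lborel A)"
  by (intro measurable_restrict_space1) simp

lemma measurable_qnorm_level_term [measurable]:
  "(\<lambda>x. qnorm q (count_space I) (\<lambda>j. level_term s t P j x)) \<in> borel_measurable (restrict_space lborel A)"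
  for I :: "int set"
  by (rule measurable_qnorm_count_space) simp_all

text \<open>The quasi-triangle inequality is used twice, inside for the integral over
  \<open>P\<close> and outside for the sum over levels; the two constants multiply.\<close>

lemma subspace_b_space:
  assumes p: "0 < p" and q: "0 < q"
  shows "cube_seq.subspace (b_space s \<tau> p q :: 'n::finite cube_seq set)"
proof -
  obtain K1 where K1: "0 \<le> K1" "\<And>(M :: (real ^ 'n) measure) f g. f \<in> borel_measurable M \<Longrightarrow>
      g \<in> borel_measurable M \<Longrightarrow>
      qnorm p M (\<lambda>x. f x + g x) \<le> ennreal K1 * (qnorm p M f + qnorm p M g)"
    using qnorm_add_le[OF p] by blast
  obtain K2 where K2: "0 \<le> K2" "\<And>(M :: int measure) f g. f \<in> borel_measurable M \<Longrightarrow>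
      g \<in> borel_measurable M \<Longrightarrow>
      qnorm q M (\<lambda>x. f x + g x) \<le> ennreal K2 * (qnorm q M f + qnorm q M g)"
    using qnorm_add_le[OF q] by blast
  show ?thesis
    unfolding b_space_def b_qnorm_eq
  proof (rule subspace_cube_sup_finite)
    fix t u :: "'n cube_seq" and i :: int and P :: "(real ^ 'n) set"
    let ?N = "\<lambda>t j. qnorm p (restrict_space lborel P) (level_term s t P j)"
    have "?N (t + u) j \<le> ennreal K1 * (?N t j + ?N u j)" for j
    proof -
      have "?N (t + u) j \<le> qnorm p (restrict_space lborel P)
          (\<lambda>x. level_term s t P j x + level_term s u P j x)"
        by (intro qnorm_mono) (simp_all add: level_term_add_le)
      also have "\<dots> \<le> ennreal K1 * (?N t j + ?N u j)"
        by (intro K1) simp_all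
      finally show ?thesis .
    qed
    then have "b_local s p q (t + u) i P
        \<le> qnorm q (count_space {i..}) (\<lambda>j. ennreal K1 * (?N t j + ?N u j))"
      unfolding b_local_def by (intro qnorm_mono) simp_all
    also have "\<dots> \<le> ennreal K1 * qnorm q (count_space {i..}) (\<lambda>j. ?N t j + ?N u j)"
      by (intro qnorm_cmult_le q) simp
    also have "\<dots> \<le> ennreal K1 * (ennreal K2 * (b_local s p q t i P + b_local s p q u i P))"
      unfolding b_local_def by (intro mult_left_mono K2) simp_all
    finally show "b_local s p q (t + u) i P
        \<le> ennreal (K1 * K2) * (b_local s p q t i P + b_local s p q u i P)"
      using K1(1) K2(1) by (simp add: ennreal_mult mult.assoc)
  next
    fix c and t :: "'n cube_seq" and i :: int and P :: "(real ^ 'n) set"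
    let ?N = "\<lambda>t j. qnorm p (restrict_space lborel P) (level_term s t P j)"
    have "?N (seq_scale c t) j \<le> ennreal (cmod c) * ?N t j" for j
      unfolding level_term_scale[abs_def] by (intro qnorm_cmult_le p) simp
    then have "b_local s p q (seq_scale c t) i P
        \<le> qnorm q (count_space {i..}) (\<lambda>j. ennreal (cmod c) * ?N t j)"
      unfolding b_local_def by (intro qnorm_mono) simp_all
    also have "\<dots> \<le> ennreal (cmod c) * b_local s p q t i P"
      unfolding b_local_def by (intro qnorm_cmult_le q) simp
    finally show "b_local s p q (seq_scale c t) i P \<le> ennreal (cmod c) * b_local s p q t i P" .
  qed
qed

lemma subspace_f_space:
  assumes p: "0 < p" and q: "0 < q"
  shows "cube_seq.subspace (f_space s \<tau> p q :: 'n::finite cube_seq set)"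
proof -
  from p have p': "0 < ennreal p" by simp
  obtain K1 where K1: "0 \<le> K1" "\<And>(M :: (real ^ 'n) measure) f g. f \<in> borel_measurable M \<Longrightarrow>
      g \<in> borel_measurable M \<Longrightarrow>
      qnorm p M (\<lambda>x. f x + g x) \<le> ennreal K1 * (qnorm p M f + qnorm p M g)"
    using qnorm_add_le[OF p'] by blast
  obtain K2 where K2: "0 \<le> K2" "\<And>(M :: int measure) f g. f \<in> borel_measurable M \<Longrightarrow>
      g \<in> borel_measurable M \<Longrightarrow>
      qnorm q M (\<lambda>x. f x + g x) \<le> ennreal K2 * (qnorm q M f + qnorm q M g)"
    using qnorm_add_le[OF q] by blast
  show ?thesis
    unfolding f_space_def f_qnorm_eq[OF q]
  proof (rule subspace_cube_sup_finite)
    fix t u :: "'n cube_seq" and i :: int and P :: "(real ^ 'n) set"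
    let ?N = "\<lambda>t x. qnorm q (count_space {i..}) (\<lambda>j. level_term s t P j x)"
    have "?N (t + u) x \<le> ennreal K2 * (?N t x + ?N u x)" for x
    proof -
      have "?N (t + u) x \<le> qnorm q (count_space {i..})
          (\<lambda>j. level_term s t P j x + level_term s u P j x)"
        by (intro qnorm_mono) (simp_all add: level_term_add_le)
      also have "\<dots> \<le> ennreal K2 * (?N t x + ?N u x)"
        by (intro K2) simp_all
      finally show ?thesis .
    qed
    then have "f_local s p q (t + u) i P
        \<le> qnorm p (restrict_space lborel P) (\<lambda>x. ennreal K2 * (?N t x + ?N u x))"
      unfolding f_local_def by (intro qnorm_mono) simp_all
    also have "\<dots> \<le> ennreal K2 * qnorm p (restrict_space lborel P) (\<lambda>x. ?N t x + ?N u x)"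
      by (intro qnorm_cmult_le p') simp
    also have "\<dots> \<le> ennreal K2 * (ennreal K1 * (f_local s p q t i P + f_local s p q u i P))"
      unfolding f_local_def by (intro mult_left_mono K1) simp_all
    finally show "f_local s p q (t + u) i P
        \<le> ennreal (K2 * K1) * (f_local s p q t i P + f_local s p q u i P)"
      using K1(1) K2(1) by (simp add: ennreal_mult mult.assoc)
  next
    fix c and t :: "'n cube_seq" and i :: int and P :: "(real ^ 'n) set"
    let ?N = "\<lambda>t x. qnorm q (count_space {i..}) (\<lambda>j. level_term s t P j x)"
    have "?N (seq_scale c t) x \<le> ennreal (cmod c) * ?N t x" for x
      unfolding level_term_scale by (intro qnorm_cmult_le q) simp
    then have "f_local s p q (seq_scale c t) i P
        \<le> qnorm p (restrict_space lborel P) (\<lambda>x. ennreal (cmod c) * ?N t x)"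
      unfolding f_local_def by (intro qnorm_mono) simp_all
    also have "\<dots> \<le> ennreal (cmod c) * f_local s p q t i P"
      unfolding f_local_def by (intro qnorm_cmult_le p') simp
    finally show "f_local s p q (seq_scale c t) i P \<le> ennreal (cmod c) * f_local s p q t i P" .
  qed
qed

section \<open>Inclusions by Hoelder and Tonelli\<close>

lemma sigma_finite_restrict_lborel:
  "P \<in> sets borel \<Longrightarrow> sigma_finite_measure (restrict_space lborel P)"
  by (intro sigma_finite_measure_restrict_space) (simp_all add: lborel.sigma_finite_measure_axioms)

text \<open>With equal exponents the two local quasi-norms differ only in the order of integrating
  over \<open>P\<close> and summing over levels.\<close>

lemma f_local_le_b_local:
  assumes "P \<in> dyadic_cubes_at i" "0 < q"
  shows "f_local s q q t i P \<le> b_local s q q t i P"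
  unfolding f_local_def b_local_def using assms(2)
  by (rule qnorm_swap_le) (simp_all add: sigma_finite_restrict_lborel dyadic_cubes_atD[OF assms(1)])

lemma qnorm_mono_exponent_cube:
  fixes P :: "(real ^ 'n::finite) set"
  assumes P: "P \<in> dyadic_cubes_at i" and p: "0 < p" "ennreal p < q"
    and f: "f \<in> borel_measurable (restrict_space lborel P)"
  shows "qnorm (ennreal p) (restrict_space lborel P) f
    \<le> ennreal (2 powr (1 / p) * measure lborel P powr (1 / p - recip q)) * qnorm q (restrict_space lborel P) f"
proof (rule qnorm_mono_exponent[OF p _ _ f])
  show "emeasure (restrict_space lborel P) (space (restrict_space lborel P)) = ennreal (measure lborel P)"
    using dyadic_cubes_atD[OF P] by (simp add: emeasure_restrict_space space_restrict_space)
  show "0 < measure lborel P"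
    using dyadic_cubes_atD[OF P] by simp
qed

text \<open>A local factor \<open>measure lborel P powr a\<close> is absorbed by shifting the
  exponent of the weight. Taking \<open>a = 1 / p - recip q\<close> leads from \<tau> + 1/q - 1/p to
  \<tau>.\<close>

lemma cube_sup_comparison:
  fixes L L' :: "int \<Rightarrow> (real ^ 'n::finite) set \<Rightarrow> ennreal"
  assumes C: "0 \<le> C"
    and le: "\<And>i P. P \<in> dyadic_cubes_at i \<Longrightarrow> L i P \<le> ennreal (C * measure lborel P powr a) * L' i P"
  shows "cube_sup (\<sigma> + a) L \<le> ennreal C * cube_sup \<sigma> L'"
proof (rule cube_sup_le)
  fix i :: int and P :: "(real ^ 'n) set"
  assume P: "P \<in> dyadic_cubes_at i"
  have "L i P \<le> ennreal (C * measure lborel P powr a) * L' i P"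
    by (rule le[OF P])
  also have "\<dots> \<le> ennreal (C * measure lborel P powr a) * (ennreal (measure lborel P powr \<sigma>) * cube_sup \<sigma> L')"
    by (intro mult_left_mono le_cube_sup P) simp
  also have "\<dots> = ennreal (measure lborel P powr (\<sigma> + a)) * (ennreal C * cube_sup \<sigma> L')"
    using C by (simp add: powr_add ennreal_mult mult_ac)
  finally show "L i P \<le> \<dots>" .
qed

text \<open>Hoelder is applied level by level, and its constant is then pulled out of the sum over
  levels.\<close>

lemma b_space_subset_b_space:
  assumes p: "0 < p" "ennreal p < q"
  shows "b_space s (\<tau> + recip q - 1 / p) q q \<subseteq> (b_space s \<tau> (ennreal p) q :: 'n::finite cube_seq set)"
proof -
  from p have q: "0 < q" by (metis ennreal_less_zero_iff order.strict_trans)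
  have "b_qnorm s \<tau> (ennreal p) q t \<le> ennreal (2 powr (1 / p)) * b_qnorm s (\<tau> + recip q - 1 / p) q q t"
    for t :: "'n cube_seq"
  proof -
    have "cube_sup (\<tau> + recip q - 1 / p + (1 / p - recip q)) (b_local s (ennreal p) q t)
        \<le> ennreal (2 powr (1 / p)) * cube_sup (\<tau> + recip q - 1 / p) (b_local s q q t)"
    proof (rule cube_sup_comparison)
      fix i :: int and P :: "(real ^ 'n) set"
      assume P: "P \<in> dyadic_cubes_at i"
      let ?c = "ennreal (2 powr (1 / p) * measure lborel P powr (1 / p - recip q))"
      have "b_local s (ennreal p) q t i P \<le> qnorm q (count_space {i..})
          (\<lambda>j. ?c * qnorm q (restrict_space lborel P) (level_term s t P j))"
        unfolding b_local_def
        by (intro qnorm_mono AE_I2 qnorm_mono_exponent_cube[OF P p]) simp_all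
      also have "\<dots> \<le> ?c * b_local s q q t i P"
        unfolding b_local_def by (intro qnorm_cmult_le q) simp
      finally show "b_local s (ennreal p) q t i P \<le> ?c * b_local s q q t i P" .
    qed simp
    then show ?thesis by (simp add: b_qnorm_eq)
  qed
  moreover have "ennreal (2 powr (1 / p)) * b_qnorm s (\<tau> + recip q - 1 / p) q q t < \<infinity>"
    if "b_qnorm s (\<tau> + recip q - 1 / p) q q t < \<infinity>" for t :: "'n cube_seq"
    using that by (simp add: ennreal_mult_less_top)
  ultimately show ?thesis
    unfolding b_space_def by (blast intro: le_less_trans)
qed

text \<open>Here Hoelder is applied once, to the whole pointwise sum over levels; the interchange
  with equal exponents \<open>q\<close> follows.\<close>

lemma b_space_subset_f_space:
  assumes p: "0 < p" "ennreal p < q"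
  shows "b_space s (\<tau> + recip q - 1 / p) q q \<subseteq> (f_space s \<tau> p q :: 'n::finite cube_seq set)"
proof -
  from p have q: "0 < q" by (metis ennreal_less_zero_iff order.strict_trans)
  have "f_qnorm s \<tau> p q t \<le> ennreal (2 powr (1 / p)) * b_qnorm s (\<tau> + recip q - 1 / p) q q t"
    for t :: "'n cube_seq"
  proof -
    have "cube_sup (\<tau> + recip q - 1 / p + (1 / p - recip q)) (f_local s (ennreal p) q t)
        \<le> ennreal (2 powr (1 / p)) * cube_sup (\<tau> + recip q - 1 / p) (b_local s q q t)"
    proof (rule cube_sup_comparison)
      fix i :: int and P :: "(real ^ 'n) set"
      assume P: "P \<in> dyadic_cubes_at i"
      let ?c = "ennreal (2 powr (1 / p) * measure lborel P powr (1 / p - recip q))"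
      have "f_local s (ennreal p) q t i P \<le> ?c * f_local s q q t i P"
        unfolding f_local_def by (intro qnorm_mono_exponent_cube[OF P p]) simp
      also have "\<dots> \<le> ?c * b_local s q q t i P"
        by (intro mult_left_mono f_local_le_b_local[OF P q]) simp
      finally show "f_local s (ennreal p) q t i P \<le> ?c * b_local s q q t i P" .
    qed simp
    then show ?thesis by (simp add: b_qnorm_eq f_qnorm_eq[OF q])
  qed
  moreover have "ennreal (2 powr (1 / p)) * b_qnorm s (\<tau> + recip q - 1 / p) q q t < \<infinity>"
    if "b_qnorm s (\<tau> + recip q - 1 / p) q q t < \<infinity>" for t :: "'n cube_seq"
    using that by (simp add: ennreal_mult_less_top)
  ultimately show ?thesis
    unfolding b_space_def f_space_def by (blast intro: le_less_trans)
qed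

text \<open>Pointwise, the sequence norm with exponent \<open>q\<close> is dominated by the one with
  exponent \<open>p\<close>, after which the order can be interchanged. This carries the
  counterexample over to the Triebel-Lizorkin case.\<close>

lemma b_space_diagonal_subset_f_space:
  assumes p: "0 < p" "ennreal p < q"
  shows "b_space s \<tau> (ennreal p) (ennreal p) \<subseteq> (f_space s \<tau> p q :: 'n::finite cube_seq set)"
proof -
  from p have q: "0 < q" by (metis ennreal_less_zero_iff order.strict_trans)
  have "f_qnorm s \<tau> p q t \<le> b_qnorm s \<tau> (ennreal p) (ennreal p) t" for t :: "'n cube_seq"
  proof -
    have "cube_sup (\<tau> + 0) (f_local s (ennreal p) q t)
        \<le> ennreal 1 * cube_sup \<tau> (b_local s (ennreal p) (ennreal p) t)"
    proof (rule cube_sup_comparison)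
      fix i :: int and P :: "(real ^ 'n) set"
      assume P: "P \<in> dyadic_cubes_at i"
      have "f_local s (ennreal p) q t i P \<le> f_local s (ennreal p) (ennreal p) t i P"
        unfolding f_local_def
        by (intro qnorm_mono AE_I2 qnorm_count_space_antimono_exponent p) simp
      also have "\<dots> \<le> b_local s (ennreal p) (ennreal p) t i P"
        using p by (intro f_local_le_b_local[OF P]) simp
      finally show "f_local s (ennreal p) q t i P
          \<le> ennreal (1 * measure lborel P powr 0) * b_local s (ennreal p) (ennreal p) t i P"
        using dyadic_cubes_atD[OF P] by simp
    qed simp
    then show ?thesis by (simp add: b_qnorm_eq f_qnorm_eq[OF q])
  qed
  then show ?thesis
    by (auto simp: b_space_def f_space_def intro: le_less_trans)
qed

section \<open>A sequence concentrated at a corner\<close>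

text \<open>The summand \<open>s / n + 1 / 2\<close> cancels the normalization in
  \<open>seq_term\<close>, leaving height \<open>measure lborel Q powr \<beta>\<close> on each cube
  with lower corner at the origin.\<close>

definition corner_seq :: "real \<Rightarrow> real \<Rightarrow> 'n::finite cube_seq" where
  "corner_seq s \<beta> Q = (if Q \<in> range (\<lambda>j. dyadic_cube j 0)
     then complex_of_real (measure lborel Q powr (s / real CARD('n) + 1 / 2 + \<beta>)) else 0)"

lemma level_term_corner_seq:
  fixes P :: "(real ^ 'n::finite) set"
  shows "level_term s (corner_seq s \<beta>) P j x =
    (if dyadic_cube j 0 \<subseteq> P
     then ennreal (measure lborel (dyadic_cube j (0 :: int ^ 'n)) powr \<beta>) * indicator (dyadic_cube j 0) x
     else 0)"
proof -
  have mem: "dyadic_cube j (0 :: int ^ 'n) \<in> dyadic_cubes_at j"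
    by (simp add: dyadic_cubes_at_def)
  show ?thesis
  proof (cases "x \<in> dyadic_cube j 0")
    case True
    then have "cube_at j x = dyadic_cube j 0"
      using dyadic_cubes_at_unique[OF mem] by simp
    moreover have "measure lborel (dyadic_cube j (0 :: int ^ 'n)) powr (- s / real CARD('n) - 1 / 2) *
        measure lborel (dyadic_cube j (0 :: int ^ 'n)) powr (s / real CARD('n) + 1 / 2 + \<beta>)
      = measure lborel (dyadic_cube j (0 :: int ^ 'n)) powr \<beta>"
      by (simp flip: powr_add)
    ultimately show ?thesis
      using True by (simp add: level_term_eq seq_term_def corner_seq_def)
  next
    case False
    \<comment> \<open>The cube through \<open>x\<close> has level \<open>j\<close>, so it could only
      be the corner cube of that level, which misses \<open>x\<close>.\<close>
    have "cube_at j x \<noteq> dyadic_cube j' 0" for j'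
    proof
      assume *: "cube_at j x = dyadic_cube j' 0"
      then have "cube_at j x \<in> dyadic_cubes_at j'"
        by (simp add: dyadic_cubes_at_def)
      then have "j' = j"
        using cube_at_in_dyadic_cubes_at dyadic_cubes_at_disjoint_levels by metis
      with * False cube_at_mem[of x j] show False by simp
    qed
    then have "corner_seq s \<beta> (cube_at j x) = 0"
      by (auto simp: corner_seq_def)
    with False show ?thesis
      by (simp add: level_term_eq seq_term_def)
  qed
qed

text \<open>Positivity of \<open>v\<close> matters for \<open>r = top\<close>: the essential
  supremum ignores null sets, and \<open>v powr 0\<close> is 1 only for nonzero
  \<open>v\<close>.\<close>

lemma qnorm_indicator:
  assumes r: "0 < r" and QP: "Q \<subseteq> P" "Q \<in> sets borel" "P \<in> sets borel"
    and v: "emeasure lborel Q = ennreal v" "0 < v" and c: "0 \<le> c"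
  shows "qnorm r (restrict_space lborel P) (\<lambda>x. ennreal c * indicator Q x) = ennreal (c * v powr recip r)"
proof (cases r rule: exponent_cases)
  case 1
  let ?M = "restrict_space lborel P" and ?f = "\<lambda>x. ennreal c * indicator Q x"
  have [measurable]: "Q \<in> sets borel"
    by (rule QP)
  have f: "?f \<in> borel_measurable ?M"
    by (intro measurable_restrict_space1) measurable
  have "ennreal c \<le> esssup ?M ?f"
  proof (rule ccontr)
    assume "\<not> ennreal c \<le> esssup ?M ?f"
    then have "x \<notin> Q" if "?f x \<le> esssup ?M ?f" for x
      using that by (auto simp: indicator_def)
    then have "AE x in ?M. x \<notin> Q"
      using esssup_AE[of ?f ?M] by (rule eventually_mono[rotated])
    then have "AE x in lborel. x \<notin> Q"
      using QP by (auto simp: AE_restrict_space_iff elim!: eventually_mono)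
    then have "emeasure lborel Q = 0"
      using QP by (simp add: AE_iff_measurable[of Q])
    with v show False by simp
  qed
  moreover have "esssup ?M ?f \<le> ennreal c"
    by (intro esssup_I[OF f] AE_I2) (auto simp: indicator_def)
  ultimately show ?thesis
    using v by (simp add: 1 qnorm_top)
next
  case (2 e)
  with r have e: "0 < e" by simp
  have "qnorm r (restrict_space lborel P) (\<lambda>x. ennreal c * indicator Q x)
      = epowr (\<integral>\<^sup>+x. ennreal (c powr e) * indicator Q x \<partial>lborel) (1 / e)"
    using QP 2 c e
    by (auto simp: qnorm_ennreal nn_integral_restrict_space epowr_ennreal
        intro!: arg_cong2[where f = epowr] nn_integral_cong split: split_indicator)
  also have "\<dots> = ennreal (c * v powr (1 / e))"
    using QP v c e
    by (simp add: nn_integral_cmult_indicator epowr_ennreal powr_mult powr_powr flip: ennreal_mult)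
  finally show ?thesis
    using 2 e by simp
qed

lemma qnorm_level_term_corner_seq:
  fixes P :: "(real ^ 'n::finite) set"
  assumes P: "P \<in> dyadic_cubes_at i" and r: "0 < r"
  shows "qnorm r (restrict_space lborel P) (level_term s (corner_seq s \<beta>) P j) =
    (if dyadic_cube j 0 \<subseteq> P then ennreal (2 powr (- real CARD('n) * real_of_int j * (\<beta> + recip r))) else 0)"
proof (cases "dyadic_cube j 0 \<subseteq> P")
  case True
  let ?Q = "dyadic_cube j (0 :: int ^ 'n)"
  have Q: "?Q \<in> dyadic_cubes_at j"
    by (simp add: dyadic_cubes_at_def)
  have "qnorm r (restrict_space lborel P) (level_term s (corner_seq s \<beta>) P j)
      = qnorm r (restrict_space lborel P) (\<lambda>x. ennreal (measure lborel ?Q powr \<beta>) * indicator ?Q x)"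
    using True by (intro arg_cong[where f = "qnorm r _"] ext) (simp add: level_term_corner_seq)
  also have "\<dots> = ennreal (measure lborel ?Q powr \<beta> * measure lborel ?Q powr recip r)"
    using dyadic_cubes_atD[OF Q] dyadic_cubes_atD[OF P] True r by (intro qnorm_indicator) auto
  also have "\<dots> = ennreal (2 powr (- real CARD('n) * real_of_int j * (\<beta> + recip r)))"
    unfolding dyadic_cubes_atD(3)[OF Q] by (simp add: powr_powr algebra_simps flip: powr_add)
  finally show ?thesis using True by simp
next
  case False
  then have "level_term s (corner_seq s \<beta>) P j = (\<lambda>x. 0)"
    by (intro ext) (simp add: level_term_corner_seq)
  then show ?thesis
    using False r by (cases r rule: exponent_cases)
      (auto simp: qnorm_top qnorm_ennreal intro!: antisym esssup_I)
qed

text \<open>A geometric tail is comparable to its first term, with a constant independent of the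
  starting level \<open>i\<close>. For \<open>q = \<infinity>\<close> the supremum is the first term
  itself, which also admits \<delta> = 0.\<close>

lemma qnorm_geometric:
  assumes q: "0 < q" and \<delta>: "0 < \<delta> \<or> q = \<infinity> \<and> \<delta> = 0"
  obtains C :: real where "0 \<le> C"
    "\<And>i :: int. qnorm q (count_space {i..}) (\<lambda>j. ennreal (2 powr (- real_of_int j * \<delta>)))
       \<le> ennreal (C * 2 powr (- real_of_int i * \<delta>))"
proof (cases q rule: exponent_cases)
  case 1
  show ?thesis
  proof (rule that[of 1])
    fix i :: int
    show "qnorm q (count_space {i..}) (\<lambda>j. ennreal (2 powr (- real_of_int j * \<delta>)))
        \<le> ennreal (1 * 2 powr (- real_of_int i * \<delta>))"
      unfolding 1 qnorm_top esssup_count_space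
      using \<delta> by (intro SUP_least ennreal_leI) (auto intro!: mult_right_mono)
  qed simp
next
  case (2 e)
  with q \<delta> have e: "0 < e" and \<delta>': "0 < \<delta>" by auto
  define \<rho> where "\<rho> = 2 powr (- \<delta> * e)"
  have \<rho>: "0 < \<rho>" "\<rho> < 1"
    using e \<delta>' by (auto simp: \<rho>_def powr_less_one)
  show ?thesis
  proof (rule that[of "(1 / (1 - \<rho>)) powr (1 / e)"])
    fix i :: int
    let ?A = "2 powr (- real_of_int i * \<delta>) :: real"
    \<comment> \<open>Shifting by \<open>i\<close> turns the tail into a series over the naturals
      with ratio \<rho>.\<close>
    have bij: "bij_betw (\<lambda>k. i + int k) UNIV {i..}"
      by (rule bij_betwI[where g = "\<lambda>j. nat (j - i)"]) auto
    have "(\<integral>\<^sup>+j. epowr (ennreal (2 powr (- real_of_int j * \<delta>))) e \<partial>count_space {i..})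
        = (\<Sum>k. epowr (ennreal (2 powr (- real_of_int (i + int k) * \<delta>))) e)"
      unfolding nn_integral_bij_count_space[OF bij, symmetric] nn_integral_count_space_nat ..
    also have "\<dots> = (\<Sum>k. ennreal (?A powr e * \<rho> ^ k))"
      by (intro suminf_cong arg_cong[where f = ennreal])
        (simp add: epowr_ennreal \<rho>_def powr_powr algebra_simps flip: powr_realpow powr_add)
    also have "\<dots> = ennreal (\<Sum>k. ?A powr e * \<rho> ^ k)"
      using \<rho> by (intro suminf_ennreal2 summable_mult summable_geometric) auto
    also have "(\<Sum>k. ?A powr e * \<rho> ^ k) = ?A powr e * (1 / (1 - \<rho>))"
      using \<rho> by (simp add: suminf_mult summable_geometric suminf_geometric)
    finally show "qnorm q (count_space {i..}) (\<lambda>j. ennreal (2 powr (- real_of_int j * \<delta>)))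
        \<le> ennreal ((1 / (1 - \<rho>)) powr (1 / e) * ?A)"
      using \<rho> e 2 by (simp add: qnorm_ennreal epowr_ennreal powr_mult powr_divide powr_powr mult.commute)
  qed simp
qed

lemma corner_seq_outside: "Q \<notin> dyadic_cubes \<Longrightarrow> corner_seq s \<beta> Q = 0"
  by (auto simp: corner_seq_def dyadic_cubes_def dyadic_cubes_at_def)

lemma corner_seq_in_b_space:
  assumes p: "0 < p" and q: "0 < q" and \<tau>: "0 < \<tau> \<or> q = \<infinity> \<and> \<tau> = 0"
  shows "corner_seq s (\<tau> - 1 / p) \<in> (b_space s \<tau> (ennreal p) q :: 'n::finite cube_seq set)"
proof -
  let ?\<delta> = "real CARD('n) * \<tau>"
  let ?t = "corner_seq s (\<tau> - 1 / p) :: 'n cube_seq"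
  have "0 < ?\<delta> \<or> q = \<infinity> \<and> ?\<delta> = 0" using \<tau> by auto
  then obtain C where C: "0 \<le> C" and geo:
    "\<And>i :: int. qnorm q (count_space {i..}) (\<lambda>j. ennreal (2 powr (- real_of_int j * ?\<delta>)))
       \<le> ennreal (C * 2 powr (- real_of_int i * ?\<delta>))"
    using qnorm_geometric[OF q] by blast
  have "cube_sup \<tau> (b_local s (ennreal p) q ?t) \<le> ennreal C"
  proof (rule cube_sup_le)
    fix i :: int and P :: "(real ^ 'n) set"
    assume P: "P \<in> dyadic_cubes_at i"
    \<comment> \<open>Corner cubes not contained in \<open>P\<close> contribute 0, so the full
      geometric tail is an upper bound wherever \<open>P\<close> lies.\<close>
    have "b_local s (ennreal p) q ?t i P
        \<le> qnorm q (count_space {i..}) (\<lambda>j. ennreal (2 powr (- real_of_int j * ?\<delta>)))"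
      unfolding b_local_def using p
      by (intro qnorm_mono AE_I2) (simp_all add: qnorm_level_term_corner_seq[OF P] mult_ac)
    also have "\<dots> \<le> ennreal (C * 2 powr (- real_of_int i * ?\<delta>))"
      by (rule geo)
    also have "\<dots> = ennreal (measure lborel P powr \<tau>) * ennreal C"
      using C dyadic_cubes_atD[OF P] by (simp add: powr_powr mult_ac flip: ennreal_mult)
    finally show "b_local s (ennreal p) q ?t i P \<le> \<dots>" .
  qed
  then show ?thesis
    by (auto simp: b_space_def b_qnorm_eq corner_seq_outside intro: le_less_trans)
qed

text \<open>For finite \<open>q\<close> infinitely many terms are at least 1, so the sum diverges
  even for \<delta> = 0. A supremum is infinite only under genuine growth, hence the strict
  condition for \<open>q = \<infinity>\<close>.\<close>

lemma qnorm_nondecreasing_powr_eq_top: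
  assumes q: "0 < q" and \<delta>: "0 \<le> \<delta>" "q = \<infinity> \<Longrightarrow> 0 < \<delta>"
  shows "qnorm q (count_space {0 :: int..}) (\<lambda>j. ennreal (2 powr (real_of_int j * \<delta>))) = \<infinity>"
proof (cases q rule: exponent_cases)
  case 1
  with \<delta> have \<delta>': "0 < \<delta>" by simp
  have "of_nat m \<le> (SUP j\<in>{0 :: int..}. ennreal (2 powr (real_of_int j * \<delta>)))" for m
  proof -
    \<comment> \<open>Then \<open>j\<close> times \<delta> is at least \<open>m\<close>, and
      \<open>2 powr m\<close> exceeds \<open>m\<close>.\<close>
    define j where "j = \<lceil>real m / \<delta>\<rceil>"
    have "real m \<le> 2 powr real m"
      by (simp add: powr_realpow of_nat_less_two_power less_imp_le)
    also have "2 powr real m \<le> 2 powr (real_of_int j * \<delta>)"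
      using le_of_int_ceiling[of "real m / \<delta>"] \<delta>' unfolding j_def
      by (simp only: pos_divide_le_eq) simp
    finally have "of_nat m \<le> ennreal (2 powr (real_of_int j * \<delta>))"
      by (simp add: ennreal_of_nat_eq_real_of_nat ennreal_leI)
    moreover have "0 \<le> real m / \<delta>"
      using \<delta>' by simp
    then have "j \<in> {0..}"
      unfolding j_def atLeast_iff zero_le_ceiling by linarith
    ultimately show ?thesis
      by (rule SUP_upper2[rotated])
  qed
  then show ?thesis
    unfolding 1 qnorm_top esssup_count_space
    by (metis ennreal_Ex_less_of_nat infinity_ennreal_def less_top linorder_not_less)
next
  case (2 e)
  with q have e: "0 < e" by simp
  have "infinite {0 :: int..}"
    by (simp add: infinite_Ici)
  then have "\<infinity> = (\<integral>\<^sup>+j. 1 \<partial>count_space {0 :: int..})"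
    by simp
  also have "\<dots> \<le> (\<integral>\<^sup>+j. epowr (ennreal (2 powr (real_of_int j * \<delta>))) e \<partial>count_space {0 :: int..})"
    using \<delta> e by (intro nn_integral_mono) (auto simp: epowr_ennreal powr_powr ge_one_powr_ge_zero)
  finally show ?thesis
    using 2 by (simp add: qnorm_ennreal top_unique)
qed

lemma corner_seq_notin_b_space:
  assumes q: "0 < q" and \<sigma>: "\<sigma> \<le> 0" "q = \<infinity> \<Longrightarrow> \<sigma> < 0"
  shows "corner_seq s (\<sigma> - recip q) \<notin> (b_space s \<sigma> q q :: 'n::finite cube_seq set)"
proof -
  let ?t = "corner_seq s (\<sigma> - recip q) :: 'n cube_seq"
  \<comment> \<open>The unit cube contains every corner cube of nonnegative level, so this one
    \<open>P\<close> already makes the supremum infinite.\<close>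
  let ?P = "dyadic_cube 0 (0 :: int ^ 'n)"
  have P: "?P \<in> dyadic_cubes_at 0"
    by (simp add: dyadic_cubes_at_def)
  have sub: "dyadic_cube j (0 :: int ^ 'n) \<subseteq> ?P" if "0 \<le> j" for j
  proof -
    have "(2 :: real) powi (- j) \<le> 1"
      using that by (simp add: power_int_minus inverse_le_1_iff one_le_power_int)
    then show ?thesis
      by (auto simp: dyadic_cube_def intro: less_le_trans)
  qed
  \<comment> \<open>The two sequences are compared only on levels at least 0, hence by monotonicity
    in both directions.\<close>
  have "b_local s q q ?t 0 ?P
      = qnorm q (count_space {0 :: int..}) (\<lambda>j. ennreal (2 powr (real_of_int j * (real CARD('n) * - \<sigma>))))"
    unfolding b_local_def
    by (intro antisym qnorm_mono AE_I2) (simp_all add: qnorm_level_term_corner_seq[OF P q] sub mult_ac)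
  also have "\<dots> = \<infinity>"
    using q \<sigma> by (intro qnorm_nondecreasing_powr_eq_top) (auto simp: mult_nonneg_nonpos mult_less_0_iff)
  finally have "\<infinity> \<le> ennreal (measure lborel ?P powr \<sigma>) * cube_sup \<sigma> (b_local s q q ?t)"
    using le_cube_sup[OF P, of "b_local s q q ?t" \<sigma>] by simp
  then have "cube_sup \<sigma> (b_local s q q ?t) = \<infinity>"
    using dyadic_cubes_atD(3)[OF P] by (simp add: top_unique)
  then show ?thesis
    by (simp add: b_space_def b_qnorm_eq)
qed

theorem proposition4:
  fixes s p \<tau> :: real and q :: ennreal
  assumes "0 < p"
  shows
    "((ennreal p < q \<and> q < \<infinity> \<and> \<tau> \<in> {0<..1 / p - recip q} \<or>
       q = \<infinity> \<and> \<tau> \<in> {0<..<1 / p - recip q}) \<longrightarrow>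
      proper_subspace
        (b_space s (\<tau> + recip q - 1 / p) q q :: 'n::finite cube_seq set)
        (f_space s \<tau> p q)) \<and>
     ((ennreal p < q \<and> q < \<infinity> \<and> \<tau> \<in> {0<..1 / p - recip q} \<or>
       q = \<infinity> \<and> \<tau> \<in> {0..<1 / p - recip q}) \<longrightarrow>
      proper_subspace
        (b_space s (\<tau> + recip q - 1 / p) q q :: 'n cube_seq set)
        (b_space s \<tau> (ennreal p) q))"
proof -
  let ?t = "corner_seq s (\<tau> - 1 / p) :: 'n cube_seq"
  \<comment> \<open>With \<sigma> = \<tau> + 1/q - 1/p one has \<sigma> - 1/q = \<tau> - 1/p, so the
    same sequence witnesses both membership and failure.\<close>
  have notin: "?t \<notin> b_space s (\<tau> + recip q - 1 / p) q q"
    if "0 < q" "\<tau> \<le> 1 / p - recip q" "q = \<infinity> \<Longrightarrow> \<tau> < 1 / p - recip q"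
    using corner_seq_notin_b_space[of q "\<tau> + recip q - 1 / p" s] that by simp
  show ?thesis
  proof (intro conjI impI)
    assume asm: "ennreal p < q \<and> q < \<infinity> \<and> \<tau> \<in> {0<..1 / p - recip q} \<or>
      q = \<infinity> \<and> \<tau> \<in> {0<..<1 / p - recip q}"
    then have pq: "ennreal p < q" by auto
    with assms have q: "0 < q" by (metis ennreal_less_zero_iff order.strict_trans)
    \<comment> \<open>The sum over levels has the finite exponent \<open>p\<close> here, so
      summability rests on \<tau> > 0, also when \<open>q = \<infinity>\<close>.\<close>
    have "?t \<in> b_space s \<tau> (ennreal p) (ennreal p)"
      using asm assms by (intro corner_seq_in_b_space) auto
    then have "?t \<in> f_space s \<tau> p q"
      using b_space_diagonal_subset_f_space[OF assms pq] by blast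
    moreover have "?t \<notin> b_space s (\<tau> + recip q - 1 / p) q q"
      using asm q by (intro notin) auto
    ultimately show "proper_subspace (b_space s (\<tau> + recip q - 1 / p) q q :: 'n cube_seq set)
        (f_space s \<tau> p q)"
      unfolding proper_subspace_def
      using subspace_b_space[OF q q] subspace_f_space[OF assms q]
        b_space_subset_f_space[OF assms pq] by blast
  next
    assume asm: "ennreal p < q \<and> q < \<infinity> \<and> \<tau> \<in> {0<..1 / p - recip q} \<or>
      q = \<infinity> \<and> \<tau> \<in> {0..<1 / p - recip q}"
    then have pq: "ennreal p < q" by auto
    with assms have q: "0 < q" by (metis ennreal_less_zero_iff order.strict_trans)
    \<comment> \<open>Here the exponent over levels is \<open>q\<close>; for
      \<open>q = \<infinity>\<close> it is a supremum, which allows \<tau> = 0.\<close>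
    have "?t \<in> b_space s \<tau> (ennreal p) q"
      using asm assms q by (intro corner_seq_in_b_space) auto
    moreover have "?t \<notin> b_space s (\<tau> + recip q - 1 / p) q q"
      using asm q by (intro notin) auto
    moreover have "0 < ennreal p"
      using assms by simp
    ultimately show "proper_subspace (b_space s (\<tau> + recip q - 1 / p) q q :: 'n cube_seq set)
        (b_space s \<tau> (ennreal p) q)"
      unfolding proper_subspace_def
      using subspace_b_space[OF q q] subspace_b_space[of "ennreal p" q] q
        b_space_subset_b_space[OF assms pq] by blast
  qed
qed

end
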